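(* Let $X$ be an arbitrary nonempty set and let $Y$ be a completely regular Hausdorff pseudocompact space. Let $H,L: X\times Y\to\mathbb{R}$ be two mappings such that $H$ is bounded on $X\times Y$, $L(\cdot,y)$ is bounded on $X$ for every $y\in Y$, and: (i) $H$ is infsup-convex on $X$ and the family $\mathrm{conv}\{H(x,\cdot): x\in X\}$ is (contained and) relatively compact in $\mathcal{C}(Y)=\mathcal{C}_b(Y)$ for the topology of pointwise convergence on $Y$ (this is the case in particular if $\{H(x,\cdot): x\in X\}$ is equicontinuous on $Y$); (ii) $L$ is supinf-concave on $Y$; (iii) $H\leq L$ on $X\times Y$. Then $$\inf_{x\in X}\sup_{y\in Y} H(x,y)\leq\sup_{y\in Y}\inf_{x\in X} L(x,y).$$
   Context: A topological space is pseudocompact if its image under every real-valued continuous function is bounded. $\mathcal{C}(Y)$ (resp. $\mathcal{C}_b(Y)$) is the space of real-valued continuous (resp. bounded continuous) functions on $Y$; they coincide for pseudocompact $Y$. $\mathrm{conv}$ denotes the convex hull. For $n\ge 1$, $\Delta_n=\{(\lambda_1,\dots,\lambda_n)\in\mathbb{R}_+^n:\sum_{i=1}^n\lambda_i=1\}$. A function $f:X\times Y\to\mathbb{R}$ is infsup-convex on $X$ if $$\inf_{x\in X}\sup_{y\in Y} f(x,y)=\inf_{n\geq 1,\ x_1,\dots,x_n\in X,\ (\lambda_1,\dots,\lambda_n)\in\Delta_n}\ \sup_{y\in Y}\sum_{i=1}^n\lambda_i f(x_i,y),$$ and supinf-concave on $Y$ if $$\sup_{y\in Y}\inf_{x\in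 X} f(x,y)=\sup_{n\geq 1,\ y_1,\dots,y_n\in Y,\ (\lambda_1,\dots,\lambda_n)\in\Delta_n}\ \inf_{x\in X}\sum_{i=1}^n\lambda_i f(x,y_i).$$ Infima and suprema are taken in the extended reals. *)

theory Defs
  imports "HOL-Analysis.Analysis" "HOL-Library.Function_Algebras"
begin

text \<open>The pointwise vector space structure on real-valued functions, so that the library's
  \<open>convex hull\<close> applies to families of functions.\<close>

instantiation "fun" :: (type, real_vector) real_vector
begin

definition scaleR_fun :: "real \<Rightarrow> ('a \<Rightarrow> 'b) \<Rightarrow> 'a \<Rightarrow> 'b"
  where "scaleR_fun c f = (\<lambda>x. c *\<^sub>R f x)"

instance
  by standard (auto simp: scaleR_fun_def fun_eq_iff scaleR_add_right scaleR_add_left)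

end

definition pseudocompact_space :: "'b topology \<Rightarrow> bool"
  where "pseudocompact_space Y \<longleftrightarrow>
    (\<forall>f. continuous_map Y euclideanreal f \<longrightarrow> bounded (f ` topspace Y))"

text \<open>The space \<open>C(Y)\<close> with the topology of pointwise convergence. As usual for
  \<open>product_topology\<close>, its points are the continuous functions on \<open>topspace Y\<close> represented
  as \<open>extensional\<close> functions, i.e. set to \<open>undefined\<close> off \<open>topspace Y\<close>.\<close>

definition Cp_space :: "'b topology \<Rightarrow> ('b \<Rightarrow> real) topology"
  where "Cp_space Y =
    subtopology (powertop_real (topspace Y)) {f. continuous_map Y euclideanreal f}"

definition relatively_compact_in :: "'c topology \<Rightarrow> 'c set \<Rightarrow> bool"
  where "relatively_compact_in T S \<longleftrightarrow> S \<subseteq> topspace T \<and> compactin T (T closure_of S)"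

text \<open>\<open>conv {H(x,\<cdot>) : x \<in> X}\<close> as a family of functions on \<open>Y\<close>. The restriction only discards the
  irrelevant values off \<open>Y\<close>; it is linear, so it may be applied after taking the hull.\<close>

definition conv_sections :: "'a set \<Rightarrow> 'b set \<Rightarrow> ('a \<Rightarrow> 'b \<Rightarrow> real) \<Rightarrow> ('b \<Rightarrow> real) set"
  where "conv_sections X Y H = (\<lambda>f. restrict f Y) ` (convex hull (H ` X))"

definition equicontinuous_on :: "'b topology \<Rightarrow> ('b \<Rightarrow> real) set \<Rightarrow> bool"
  where "equicontinuous_on Y F \<longleftrightarrow>
    (\<forall>y\<in>topspace Y. \<forall>\<epsilon>>0. \<exists>U. openin Y U \<and> y \<in> U \<and> (\<forall>f\<in>F. \<forall>z\<in>U. \<bar>f z - f y\<bar> < \<epsilon>))"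

text \<open>Only the values of \<open>l\<close> on \<open>{1..n}\<close> matter.\<close>

definition std_simplex :: "nat \<Rightarrow> (nat \<Rightarrow> real) set"
  where "std_simplex n = {l. (\<forall>i\<in>{1..n}. 0 \<le> l i) \<and> (\<Sum>i=1..n. l i) = 1}"

definition infsup_convex :: "'a set \<Rightarrow> 'b set \<Rightarrow> ('a \<Rightarrow> 'b \<Rightarrow> real) \<Rightarrow> bool"
  where "infsup_convex X Y f \<longleftrightarrow>
    (INF x\<in>X. SUP y\<in>Y. ereal (f x y)) =
    (INF (n, x, l) \<in> {(n, x, l). 1 \<le> n \<and> x \<in> {1..n} \<rightarrow> X \<and> l \<in> std_simplex n}.
       SUP y\<in>Y. ereal (\<Sum>i=1..n. l i * f (x i) y))"

definition supinf_concave :: "'a set \<Rightarrow> 'b set \<Rightarrow> ('a \<Rightarrow> 'b \<Rightarrow> real) \<Rightarrow> bool"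
  where "supinf_concave X Y f \<longleftrightarrow>
    (SUP y\<in>Y. INF x\<in>X. ereal (f x y)) =
    (SUP (n, y, l) \<in> {(n, y, l). 1 \<le> n \<and> y \<in> {1..n} \<rightarrow> Y \<and> l \<in> std_simplex n}.
       INF x\<in>X. ereal (\<Sum>i=1..n. l i * f x (y i)))"

end

theory Submission
  imports Defs
begin

text \<open>
  Suppose \<open>\<beta>\<close> lies strictly between the two sides and let \<open>F = conv {H(x,\<cdot>)}\<close>. Concavity of \<open>L\<close>, the
  inequality \<open>H \<le> L\<close> and a finite minimax argument give, for every finite \<open>A \<subseteq> Y\<close>, some \<open>f \<in> F\<close> that is
  below \<open>\<beta>\<close> on \<open>A\<close>. Choose \<open>f\<^sub>n \<in> F\<close> below \<open>\<beta>\<close> on finite sets \<open>A\<^sub>n\<close> that grow so fast that every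
  point of \<open>Y\<close> is approximated, as far as \<open>f\<^sub>0, \<dots>, f\<^sub>n\<close> can see, by points of \<open>A\<^sub>n\<^sub>+\<^sub>1\<close>. A cluster
  point of \<open>(f\<^sub>n)\<close> is continuous, hence by pseudocompactness at most \<open>\<beta>\<close> on all of \<open>Y\<close>, so
  \<open>limsup f\<^sub>n \<le> \<beta>\<close> pointwise. As continuous functions on \<open>Y\<close> attain their suprema, Simons' inequality
  yields convex combinations of the \<open>f\<^sub>n\<close> with suprema arbitrarily close to \<open>\<beta>\<close>, contradicting
  infsup-convexity of \<open>H\<close>.
\<close>

section \<open>Bounds for linear functionals on convex hulls\<close>

lemma convex_hull_linear_le:
  fixes \<phi> :: "'v::real_vector \<Rightarrow> real"
  assumes "linear \<phi>" "v \<in> convex hull S" "\<And>w. w \<in> S \<Longrightarrow> \<phi> w \<le> c"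
  shows "\<phi> v \<le> c"
proof -
  have "convex (\<phi> -` {..c})"
    using assms(1) by (intro convex_linear_vimage) auto
  then have "convex hull S \<subseteq> \<phi> -` {..c}"
    using assms(3) by (intro hull_minimal) auto
  with assms(2) show ?thesis by auto
qed

lemma convex_hull_linear_abs_le:
  fixes \<phi> :: "'v::real_vector \<Rightarrow> real"
  assumes "linear \<phi>" "v \<in> convex hull S" "\<And>w. w \<in> S \<Longrightarrow> \<bar>\<phi> w\<bar> \<le> c"
  shows "\<bar>\<phi> v\<bar> \<le> c"
proof -
  have "\<phi> w \<le> c" "- \<phi> w \<le> c" if "w \<in> S" for w
    using assms(3)[OF that] by auto
  then have "\<phi> v \<le> c" "- \<phi> v \<le> c"
    using convex_hull_linear_le[OF assms(1,2)]
      convex_hull_linear_le[OF linear_compose_neg[OF assms(1)] assms(2)] by auto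
  then show ?thesis by auto
qed

lemma linear_eval: "linear (\<lambda>f :: 'b \<Rightarrow> real. f y)"
  by (rule linearI) (auto simp: scaleR_fun_def)

lemma linear_eval_diff: "linear (\<lambda>f :: 'b \<Rightarrow> real. f z - f y)"
  by (intro linear_compose_sub linear_eval)

lemma fun_sum_scaleR_apply:
  "(\<Sum>i\<in>I. u i *\<^sub>R f i) y = (\<Sum>i\<in>I. u i * f i y)" for f :: "'i \<Rightarrow> 'b \<Rightarrow> real"
  by (induction I rule: infinite_finite_induct) (simp_all add: scaleR_fun_def)

subsection \<open>Finite minimax\<close>

text \<open>A connectedness argument. If every weight \<open>l\<close> in [0,1] were defeated by
  some \<open>f\<close> that stays below \<beta> on \<open>B\<close>, such an \<open>f\<close> would
  be below \<beta> at \<open>a\<close> or at \<open>b\<close>. The two cases give two open sets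
  covering [0,1], both of which meet it, so some \<open>l\<close> is defeated by an \<open>f\<close>
  of each kind. A convex combination of these two then violates the alternative
  \<open>alt\<close>.\<close>

lemma merge_two_points:
  fixes C :: "('b \<Rightarrow> real) set"
  assumes "convex C" and alt: "\<And>f. f \<in> C \<Longrightarrow> (\<exists>c\<in>B. \<beta> \<le> f c) \<or> \<beta> \<le> f a \<or> \<beta> \<le> f b"
  shows "\<exists>l. 0 \<le> l \<and> l \<le> 1 \<and>
    (\<forall>f\<in>C. (\<exists>c\<in>B. \<beta> \<le> f c) \<or> \<beta> \<le> l * f a + (1 - l) * f b)"
proof (rule ccontr)
  assume "\<not> ?thesis"
  then have neg: "\<exists>f\<in>C. (\<forall>c\<in>B. f c < \<beta>) \<and> l * f a + (1 - l) * f b < \<beta>"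
    if "0 \<le> l" "l \<le> 1" for l
    using that by (meson not_le)
  define D where "D = {f \<in> C. \<forall>c\<in>B. f c < \<beta>}"
  define U where "U = (\<Union>f\<in>{f\<in>D. f a < \<beta>}. {l. l * f a + (1 - l) * f b < \<beta>})"
  define V where "V = (\<Union>f\<in>{f\<in>D. f b < \<beta>}. {l. l * f a + (1 - l) * f b < \<beta>})"
  have opn: "open {l. l * p + (1 - l) * q < \<beta>}" for p q :: real
    by (intro open_Collect_less continuous_intros)
  have op: "open U" "open V"
    unfolding U_def V_def by (intro open_UN ballI opn)+
  have cov: "{0..1} \<subseteq> U \<union> V"
  proof
    fix l :: real assume l: "l \<in> {0..1}"
    then obtain f where f: "f \<in> D" "l * f a + (1 - l) * f b < \<beta>"
      using neg[of l] by (auto simp: D_def)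
    have "f a < \<beta> \<or> f b < \<beta>"
    proof (rule ccontr)
      assume "\<not> (f a < \<beta> \<or> f b < \<beta>)"
      then have "l * \<beta> + (1 - l) * \<beta> \<le> l * f a + (1 - l) * f b"
        using l by (intro add_mono mult_left_mono) auto
      then show False using f by (simp add: algebra_simps)
    qed
    then show "l \<in> U \<union> V" using f by (auto simp: U_def V_def)
  qed
  have "1 \<in> U" "0 \<in> V"
    using neg[of 1] neg[of 0] by (auto simp: U_def V_def D_def)
  moreover have "(0::real) \<in> {0..1}" "(1::real) \<in> {0..1}" by auto
  ultimately have ne: "U \<inter> {0..1} \<noteq> {}" "V \<inter> {0..1} \<noteq> {}" by blast+
  have "U \<inter> V \<inter> {0..1} \<noteq> {}"
    using connectedD[OF connected_Icc op _ cov] ne by argo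
  then obtain l where l: "l \<in> U \<inter> V \<inter> {0..1}" by blast
  then obtain f g where f: "f \<in> D" "f a < \<beta>" "l * f a + (1 - l) * f b < \<beta>"
    and g: "g \<in> D" "g b < \<beta>" "l * g a + (1 - l) * g b < \<beta>"
    by (auto simp: U_def V_def)
  \<comment> \<open>Both functions are below \<beta> on \<open>B\<close>, so \<open>alt\<close>
    forces each of them to be large at the point where it is not already known to be small.\<close>
  have fb: "\<beta> \<le> f b" and ga: "\<beta> \<le> g a"
    using alt[of f] alt[of g] f g by (auto simp: D_def not_le)
  \<comment> \<open>The point of the segment from \<open>f\<close> to \<open>g\<close> that takes equal values at \<open>a\<close> and \<open>b\<close>.\<close>
  define p where "p = f b - f a"
  define q where "q = g a - g b"
  define t where "t = p / (p + q)"
  have pq: "0 < p" "0 < q" using f g fb ga by (auto simp: p_def q_def)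
  then have t: "0 < t" "t < 1" and t': "1 - t = q / (p + q)"
    by (auto simp: t_def field_simps)
  define h where "h = (1 - t) *\<^sub>R f + t *\<^sub>R g"
  have hC: "h \<in> C"
    using \<open>convex C\<close> f g t by (auto simp: h_def D_def convex_alt)
  have h: "h c = (1 - t) * f c + t * g c" for c
    by (simp add: h_def scaleR_fun_def)
  have "h a - h b = t * q - (1 - t) * p"
    by (simp add: h p_def q_def algebra_simps)
  also have "\<dots> = 0" unfolding t' unfolding t_def by simp
  finally have eq: "h a = h b" by simp
  have mix: "h c < \<beta>" if "f c < \<beta>" "g c < \<beta>" for c
    unfolding h using that t by (intro convex_bound_lt) auto
  \<comment> \<open>The same \<open>l\<close> defeats \<open>f\<close> and \<open>g\<close>, hence
    \<open>h\<close>; as \<open>h a = h b\<close>, the mixed value is this common value.\<close>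
  have "l * h a + (1 - l) * h b = (1 - t) * (l * f a + (1 - l) * f b) + t * (l * g a + (1 - l) * g b)"
    by (simp add: h algebra_simps)
  also have "\<dots> < \<beta>" by (rule convex_bound_lt) (use f g t in auto)
  finally have "h a < \<beta>" by (simp add: eq algebra_simps)
  moreover have "\<forall>c\<in>B. h c < \<beta>" using mix f g by (auto simp: D_def)
  ultimately show False using alt[OF hC] eq by auto
qed

text \<open>The finite-dimensional minimax step: failure to get below \<beta> on all of
  \<open>A\<close> is witnessed by one probability weight. Induction on \<open>A\<close>: two points
  are merged into one by the preceding lemma, which leaves a convex family on a smaller set.\<close>

lemma finite_alternative:
  fixes C :: "('b \<Rightarrow> real) set"
  assumes "finite A" "A \<noteq> {}" "convex C" "\<And>f. f \<in> C \<Longrightarrow> \<exists>a\<in>A. \<beta> \<le> f a"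
  shows "\<exists>\<mu>. (\<forall>a\<in>A. 0 \<le> \<mu> a) \<and> sum \<mu> A = 1 \<and> (\<forall>f\<in>C. \<beta> \<le> (\<Sum>a\<in>A. \<mu> a * f a))"
  using assms
proof (induction A arbitrary: C rule: finite_ne_induct)
  case (singleton a)
  then show ?case by (intro exI[of _ "\<lambda>_. 1"]) auto
next
  case (insert a B)
  then obtain b where b: "b \<in> B" by auto
  have "(\<exists>c\<in>B - {b}. \<beta> \<le> f c) \<or> \<beta> \<le> f a \<or> \<beta> \<le> f b" if "f \<in> C" for f
    using insert.prems(2)[OF that] b by auto
  then obtain l where l: "0 \<le> l" "l \<le> 1"
    "\<And>f. f \<in> C \<Longrightarrow> (\<exists>c\<in>B - {b}. \<beta> \<le> f c) \<or> \<beta> \<le> l * f a + (1 - l) * f b"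
    using merge_two_points[OF insert.prems(1), of "B - {b}" \<beta> a b] by blast
  \<comment> \<open>\<open>T\<close> lets \<open>b\<close> stand for the merged point; being linear,
    it keeps the family convex.\<close>
  define T where "T = (\<lambda>f :: 'b \<Rightarrow> real. f(b := l * f a + (1 - l) * f b))"
  have "linear T"
    by (rule linearI) (auto simp: T_def fun_eq_iff scaleR_fun_def algebra_simps)
  then have "convex (T ` C)"
    using insert.prems(1) by (rule convex_linear_image)
  moreover have "\<exists>c\<in>B. \<beta> \<le> g c" if "g \<in> T ` C" for g
  proof -
    from that obtain f where f: "f \<in> C" "g = T f" by auto
    consider c where "c \<in> B - {b}" "\<beta> \<le> f c" | "\<beta> \<le> l * f a + (1 - l) * f b"
      using l(3)[OF f(1)] by blast
    then show ?thesis
    proof cases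
      case 1
      then show ?thesis using f(2) by (intro bexI[of _ c]) (auto simp: T_def)
    next
      case 2
      then show ?thesis using f(2) b by (intro bexI[of _ b]) (auto simp: T_def)
    qed
  qed
  ultimately obtain \<mu> where \<mu>: "\<forall>c\<in>B. 0 \<le> \<mu> c" "sum \<mu> B = 1"
    "\<forall>g\<in>T ` C. \<beta> \<le> (\<Sum>c\<in>B. \<mu> c * g c)"
    using insert.IH[of "T ` C"] by auto
  \<comment> \<open>The mass of the merged point is split again between \<open>a\<close> and
    \<open>b\<close>.\<close>
  define \<nu> where "\<nu> = \<mu>(a := l * \<mu> b, b := (1 - l) * \<mu> b)"
  have ab: "a \<noteq> b" "a \<notin> B" using b insert.hyps by auto
  have split: "sum k B = k b + sum k (B - {b})" for k :: "'b \<Rightarrow> real"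
    using b insert.hyps by (simp add: sum.remove)
  have \<nu>B: "\<nu> c = \<mu> c" if "c \<in> B - {b}" for c using that ab by (auto simp: \<nu>_def)
  have "(\<Sum>c\<in>insert a B. \<nu> c * f c) = (\<Sum>c\<in>B. \<mu> c * T f c)" for f
  proof -
    have "(\<Sum>c\<in>B - {b}. \<nu> c * f c) = (\<Sum>c\<in>B - {b}. \<mu> c * T f c)"
      by (intro sum.cong refl) (auto simp: \<nu>B T_def)
    then show ?thesis
      using ab insert.hyps by (simp add: split \<nu>_def T_def algebra_simps)
  qed
  then have "\<forall>f\<in>C. \<beta> \<le> (\<Sum>c\<in>insert a B. \<nu> c * f c)" using \<mu>(3) by auto
  moreover have "sum \<nu> (insert a B) = 1"
  proof -
    have "sum \<nu> (B - {b}) = sum \<mu> (B - {b})" by (intro sum.cong refl \<nu>B)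
    then show ?thesis
      using ab insert.hyps \<mu>(2) by (simp add: split \<nu>_def algebra_simps)
  qed
  moreover have "\<forall>c\<in>insert a B. 0 \<le> \<nu> c"
    using \<mu>(1) l b by (auto simp: \<nu>_def)
  ultimately show ?case by blast
qed

subsection \<open>Simons' inequality\<close>

lemma near_minimizer:
  fixes \<Phi> :: "'c \<Rightarrow> real"
  assumes "C \<noteq> {}" "\<And>g. g \<in> C \<Longrightarrow> b \<le> \<Phi> g" "0 < e"
  obtains g where "g \<in> C" "\<And>h. h \<in> C \<Longrightarrow> \<Phi> g \<le> \<Phi> h + e"
proof -
  have bdd: "bdd_below (\<Phi> ` C)" by (rule bdd_belowI2[OF assms(2)])
  have "\<exists>x\<in>\<Phi> ` C. x < Inf (\<Phi> ` C) + e"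
    using assms(1,3) by (intro cInf_lessD) auto
  then obtain g where g: "g \<in> C" "\<Phi> g < Inf (\<Phi> ` C) + e" by auto
  have "\<Phi> g \<le> \<Phi> h + e" if "h \<in> C" for h
    using g(2) cINF_lower[OF bdd that] by linarith
  with g(1) show thesis using that by blast
qed

text \<open>Greedy construction: \<open>g n\<close>, from the hull \<open>C n\<close> of the tail,
  nearly minimises the supremum of \<open>v n + T n g\<close>, where \<open>v n\<close> collects the
  earlier choices with geometric weights. The resulting series converges uniformly to some
  \<open>u\<close>, which attains its maximum at a point \<open>y\<close>. Near-minimality keeps
  \<open>v n\<close> low, so the tail must contribute enough at \<open>y\<close>; hence the
  \<open>f k\<close> cannot all be small there from some index on.\<close>

theorem Simons_inequality:
  fixes f :: "nat \<Rightarrow> 'b \<Rightarrow> real"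
  assumes "Y \<noteq> {}" and bound: "\<And>n y. y \<in> Y \<Longrightarrow> \<bar>f n y\<bar> \<le> M"
    and attains: "\<And>a u. (\<And>n. a n \<in> convex hull (range f)) \<Longrightarrow>
      uniform_limit Y a u sequentially \<Longrightarrow> \<exists>y\<in>Y. \<forall>z\<in>Y. u z \<le> u y"
    and lower: "\<And>h. h \<in> convex hull (range f) \<Longrightarrow> m \<le> (SUP y\<in>Y. h y)"
    and "0 < \<delta>"
  shows "\<exists>y\<in>Y. \<forall>n. \<exists>k\<ge>n. m - 2 * \<delta> \<le> f k y"
proof -
  define C where "C n = convex hull (f ` {n..})" for n
  define S where "S w = (SUP y\<in>Y. w y)" for w :: "'b \<Rightarrow> real"
  define T :: "nat \<Rightarrow> real" where "T n = (1/2) ^ n" for n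
  have T: "0 < T n" "T n \<le> 1" "T (Suc n) = T n / 2" for n
    by (auto simp: T_def power_le_one)
  have T0: "T \<longlonglongrightarrow> 0"
    unfolding T_def by (rule LIMSEQ_power_zero) auto
  have cC: "convex (C n)" for n by (simp add: C_def convex_convex_hull)
  have fC: "f n \<in> C n" for n by (auto simp: C_def intro: hull_inc)
  have CC: "C n \<subseteq> C k" if "k \<le> n" for n k
    unfolding C_def using that by (intro hull_mono) auto
  have C0: "C 0 = convex hull (range f)" by (simp add: C_def atLeast_0)
  have hb: "\<bar>h y\<bar> \<le> M" if "h \<in> C n" "y \<in> Y" for h n y
    by (rule convex_hull_linear_abs_le[OF linear_eval that(1)[unfolded C_def]])
       (use bound that(2) in auto)
  obtain y0 where y0: "y0 \<in> Y" using \<open>Y \<noteq> {}\<close> by auto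
  have M: "0 \<le> M" using bound[OF y0, of 0] by linarith
  have S_upper: "w y \<le> S w" if "\<And>y. y \<in> Y \<Longrightarrow> w y \<le> B" "y \<in> Y" for w B y
    unfolding S_def using that by (intro cSUP_upper bdd_aboveI[of _ B]) auto
  have S_least: "S w \<le> B" if "\<And>y. y \<in> Y \<Longrightarrow> w y \<le> B" for w B
    unfolding S_def using that \<open>Y \<noteq> {}\<close> by (intro cSUP_least) auto

  \<comment> \<open>This tolerance is exactly what makes the induction for \<open>v_upper\<close>
    close with the error term \<open>\<delta> * T n\<close>.\<close>
  have "\<exists>g\<in>C n. \<forall>h\<in>C n. S (w + T n *\<^sub>R g) \<le> S (w + T n *\<^sub>R h) + \<delta> * T n * T (Suc n)"
    if w: "\<And>y. y \<in> Y \<Longrightarrow> \<bar>w y\<bar> \<le> M" for n w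
  proof -
    have lo: "- (2 * M) \<le> S (w + T n *\<^sub>R h)" if h: "h \<in> C n" for h
    proof -
      have le: "\<bar>T n * h y\<bar> \<le> M" if "y \<in> Y" for y
        using mult_mono[OF T(2) hb[OF h that]] T(1)[of n] M by (simp add: abs_mult)
      have "(w + T n *\<^sub>R h) y0 \<le> S (w + T n *\<^sub>R h)"
      proof (rule S_upper[OF _ y0])
        show "(w + T n *\<^sub>R h) y \<le> 2 * M" if "y \<in> Y" for y
          using w[OF that] le[OF that] by (simp add: scaleR_fun_def)
      qed
      then show ?thesis using w[OF y0] le[OF y0] by (simp add: scaleR_fun_def)
    qed
    have "C n \<noteq> {}" using fC by auto
    moreover have "0 < \<delta> * T n * T (Suc n)" using T(1) \<open>0 < \<delta>\<close> by simp
    ultimately show ?thesis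
      using near_minimizer[of "C n" "- (2 * M)" "\<lambda>h. S (w + T n *\<^sub>R h)"] lo by metis
  qed
  then have "\<forall>n w. \<exists>g. (\<forall>y\<in>Y. \<bar>w y\<bar> \<le> M) \<longrightarrow>
      g \<in> C n \<and> (\<forall>h\<in>C n. S (w + T n *\<^sub>R g) \<le> S (w + T n *\<^sub>R h) + \<delta> * T n * T (Suc n))"
    by blast
  then obtain G where G: "\<forall>n w. (\<forall>y\<in>Y. \<bar>w y\<bar> \<le> M) \<longrightarrow> G n w \<in> C n \<and>
      (\<forall>h\<in>C n. S (w + T n *\<^sub>R G n w) \<le> S (w + T n *\<^sub>R h) + \<delta> * T n * T (Suc n))"
    by metis
  \<comment> \<open>\<open>v n\<close> uses total weight \<open>1 - T n\<close>. The choice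
    \<open>g n\<close> receives half of the remaining weight, and the other half is kept for later
    choices; \<open>a n\<close> gives it all of the remainder and so is a genuine convex
    combination.\<close>
  define v where "v = rec_nat 0 (\<lambda>n w. w + T (Suc n) *\<^sub>R G n w)"
  define g where "g n = G n (v n)" for n
  define a where "a n = v n + T n *\<^sub>R g n" for n
  have v_0: "v 0 = 0" and v_Suc: "v (Suc n) = v n + T (Suc n) *\<^sub>R g n" for n
    by (simp_all add: v_def g_def)
  \<comment> \<open>\<open>G n\<close> is only controlled at arguments bounded by \<open>M\<close>,
    so this bound has to be carried along the recursion.\<close>
  have v_bound: "\<bar>v n y\<bar> \<le> (1 - T n) * M" if y: "y \<in> Y" for n y
    using y
  proof (induction n arbitrary: y)
    case 0
    then show ?case by (simp add: v_0 T_def)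
  next
    case (Suc n)
    have *: "\<bar>v n z\<bar> \<le> M" if "z \<in> Y" for z
      using Suc.IH[OF that] T(1)[of n] M by (simp add: left_diff_distrib) (smt (verit) mult_nonneg_nonneg)
    have "\<bar>g n y\<bar> \<le> M"
      unfolding g_def using G * hb Suc.prems by blast
    then have "\<bar>T (Suc n) * g n y\<bar> \<le> T (Suc n) * M"
      using T(1)[of "Suc n"] by (simp add: abs_mult)
    with Suc.IH[OF Suc.prems] show ?case
      by (simp add: v_Suc scaleR_fun_def T(3) algebra_simps)
  qed
  have v_le: "\<bar>v n y\<bar> \<le> M" if "y \<in> Y" for n y
    using v_bound[OF that, of n] T(1)[of n] M by (simp add: left_diff_distrib) (smt (verit) mult_nonneg_nonneg)
  have gC: "g n \<in> C n" for n unfolding g_def using G v_le by blast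
  have g_min: "S (a n) \<le> S (v n + T n *\<^sub>R h) + \<delta> * T n * T (Suc n)" if "h \<in> C n" for n h
    unfolding g_def a_def using G v_le that by blast

  \<comment> \<open>All later iterates are competitors in the minimisation that defined \<open>g n\<close>.\<close>
  have tail: "\<exists>h\<in>C n. v k + T k *\<^sub>R w = v n + T n *\<^sub>R h" if "n \<le> k" "w \<in> C k" for n k w
    using that
  proof (induction k arbitrary: w rule: dec_induct)
    case base
    then show ?case by blast
  next
    case (step k)
    \<comment> \<open>Since \<open>T k\<close> is twice \<open>T (Suc k)\<close>, one step of the
      recursion is absorbed by replacing \<open>w\<close> with the midpoint of \<open>g k\<close>
      and \<open>w\<close>.\<close>
    have "v (Suc k) + T (Suc k) *\<^sub>R w = v k + T k *\<^sub>R ((1/2) *\<^sub>R g k + (1/2) *\<^sub>R w)"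
      by (simp add: v_Suc T(3) scaleR_right_distrib)
    moreover have "(1/2) *\<^sub>R g k + (1/2) *\<^sub>R w \<in> C k"
      using gC[of k] step.prems CC[of k "Suc k"] by (intro convexD[OF cC]) auto
    ultimately show ?case using step.IH by metis
  qed
  have a_tail: "\<exists>h\<in>C n. a k = v n + T n *\<^sub>R h" if "n \<le> k" for n k
    using tail[OF that gC] by (simp add: a_def)
  have a_dist: "\<bar>a k y - v n y\<bar> \<le> T n * M" if "n \<le> k" "y \<in> Y" for n k y
  proof -
    obtain h where h: "h \<in> C n" "a k = v n + T n *\<^sub>R h" using a_tail \<open>n \<le> k\<close> by blast
    then show ?thesis using hb[OF h(1) that(2)] T(1)[of n] by (simp add: scaleR_fun_def abs_mult)
  qed
  have v_conv: "\<exists>h\<in>C 0. a k = h" for k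
    using a_tail[of 0 k] by (simp add: v_0 T_def)
  have "uniformly_Cauchy_on Y a"
  proof (rule uniformly_Cauchy_onI')
    fix e :: real assume "0 < e"
    have "(\<lambda>n. T n * (2 * M)) \<longlonglongrightarrow> 0 * (2 * M)" by (intro tendsto_intros T0)
    then have "\<forall>\<^sub>F n in sequentially. T n * (2 * M) < e"
      using \<open>0 < e\<close> by (intro order_tendstoD(2)) auto
    then obtain N where N: "T N * (2 * M) < e" by (auto simp: eventually_sequentially)
    have "dist (a p y) (a n y) < e" if "N \<le> p" "p < n" "y \<in> Y" for p n y
      using a_dist[of N p y] a_dist[of N n y] that N by (simp add: dist_real_def)
    then show "\<exists>N. \<forall>x\<in>Y. \<forall>p\<ge>N. \<forall>n>p. dist (a p x) (a n x) < e" by blast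
  qed
  then obtain u where u: "uniform_limit Y a u sequentially"
    using Cauchy_uniformly_convergent uniformly_convergent_on_def by blast
  have aC: "a k \<in> convex hull (range f)" for k
    using v_conv[of k] by (simp add: C0)
  obtain y where y: "y \<in> Y" "\<And>z. z \<in> Y \<Longrightarrow> u z \<le> u y"
    using attains[OF aC u] by blast
  have lim_y: "(\<lambda>k. a k z) \<longlonglongrightarrow> u z" if "z \<in> Y" for z
    using u that by (rule tendsto_uniform_limitI)
  \<comment> \<open>Uniform convergence carries over to suprema, and the supremum of
    \<open>u\<close> is its value at \<open>y\<close>.\<close>
  have S_a: "(\<lambda>k. S (a k)) \<longlonglongrightarrow> u y"
  proof (rule tendstoI)
    fix e :: real assume "0 < e"
    then have "\<forall>\<^sub>F k in sequentially. \<forall>z\<in>Y. dist (a k z) (u z) < e / 2"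
      by (intro uniform_limitD[OF u]) simp
    then show "\<forall>\<^sub>F k in sequentially. dist (S (a k)) (u y) < e"
    proof eventually_elim
      case (elim k)
      have le: "a k z \<le> u y + e / 2" if "z \<in> Y" for z
        using bspec[OF elim that] y(2)[OF that] unfolding dist_real_def by linarith
      have "S (a k) \<le> u y + e / 2" by (rule S_least[OF le])
      moreover have "a k y \<le> S (a k)" by (rule S_upper[OF le y(1)])
      ultimately show ?case
        using bspec[OF elim y(1)] \<open>0 < e\<close> unfolding dist_real_def by linarith
    qed
  qed
  have m_le: "m \<le> u y"
    by (rule LIMSEQ_le_const[OF S_a]) (use lower[OF aC] in \<open>auto simp: S_def\<close>)
  have S_a_le: "S (a n) \<le> u y + \<delta> * T n * T (Suc n)" for n
  proof (rule LIMSEQ_le_const[OF tendsto_add[OF S_a tendsto_const]], intro exI allI impI)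
    fix k assume "n \<le> k"
    with a_tail obtain h where "h \<in> C n" "a k = v n + T n *\<^sub>R h" by blast
    with g_min show "S (a n) \<le> S (a k) + \<delta> * T n * T (Suc n)" by metis
  qed
  \<comment> \<open>\<open>v (Suc n)\<close> is the midpoint of \<open>v n\<close> and \<open>a n\<close>.\<close>
  have v_upper: "v n z \<le> (1 - T n) * (u y + \<delta> * T n)" if "z \<in> Y" for n z
  proof (induction n)
    case 0
    then show ?case by (simp add: v_0 T_def)
  next
    case (Suc n)
    have "a n z \<le> S (a n)"
    proof (rule S_upper[OF _ that])
      show "a n z \<le> M" if "z \<in> Y" for z using hb[of "a n" 0 z] aC[of n] that by (simp add: C0)
    qed
    then have le: "a n z \<le> u y + \<delta> * T n * (T n / 2)" using S_a_le[of n] by (simp add: T(3))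
    have "v (Suc n) z = (v n z + a n z) / 2"
      by (simp add: v_Suc a_def T(3) scaleR_fun_def field_simps)
    also have "\<dots> \<le> ((1 - T n) * (u y + \<delta> * T n) + (u y + \<delta> * T n * (T n / 2))) / 2"
      using Suc le by (intro divide_right_mono add_mono) auto
    also have "\<dots> = (1 - T (Suc n)) * (u y + \<delta> * T (Suc n))"
      by (simp add: T(3) field_simps)
    finally show ?case .
  qed
  have "\<exists>k\<ge>n. m - 2 * \<delta> \<le> f k y" for n
  proof (rule ccontr)
    assume "\<not> ?thesis"
    then have small: "f k y \<le> m - 2 * \<delta>" if "n \<le> k" for k using that by (meson linorder_not_le less_imp_le)
    \<comment> \<open>If the tail is small at \<open>y\<close>, so is every element of
      \<open>C n\<close>. In the limit the loss \<open>2 * \<delta> * T n\<close> outweighs the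
      error, below \<open>\<delta> * T n\<close>, that \<open>v_upper\<close> allows.\<close>
    have "a k y \<le> v n y + T n * (m - 2 * \<delta>)" if nk: "n \<le> k" for k
    proof -
      obtain h where h: "h \<in> C n" "a k = v n + T n *\<^sub>R h" using a_tail nk by blast
      have "h y \<le> m - 2 * \<delta>"
        by (rule convex_hull_linear_le[OF linear_eval h(1)[unfolded C_def]]) (use small in auto)
      then show ?thesis using h(2) T(1)[of n] by (simp add: scaleR_fun_def)
    qed
    then have "u y \<le> v n y + T n * (m - 2 * \<delta>)"
      by (intro LIMSEQ_le_const2[OF lim_y[OF y(1)]]) blast
    also have "\<dots> \<le> (1 - T n) * (u y + \<delta> * T n) + T n * (u y - 2 * \<delta>)"
      using v_upper[OF y(1), of n] m_le T(1)[of n] by (intro add_mono mult_left_mono) auto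
    also have "\<dots> = u y - T n * \<delta> * (1 + T n)" by (simp add: algebra_simps)
    finally show False using T(1)[of n] \<open>0 < \<delta>\<close> by (smt (verit) mult_pos_pos)
  qed
  then show ?thesis using y(1) by blast
qed

subsection \<open>Pseudocompactness and cluster points\<close>

lemma closure_of_real_le:
  assumes "continuous_map T euclideanreal \<Phi>" "g \<in> T closure_of S" "\<And>h. h \<in> S \<Longrightarrow> \<Phi> h \<le> c"
  shows "\<Phi> g \<le> c"
proof -
  have "closedin T {h \<in> topspace T. \<Phi> h \<in> {..c}}"
    using assms(1) by (rule closedin_continuous_map_preimage) simp
  then have "T closure_of (topspace T \<inter> S) \<subseteq> {h \<in> topspace T. \<Phi> h \<in> {..c}}"
    using assms(3) by (intro closure_of_minimal) auto
  with assms(2) show ?thesis using closure_of_restrict[of T S] by auto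
qed

lemma continuous_map_uniform_limit_real:
  fixes a :: "nat \<Rightarrow> 'b \<Rightarrow> real"
  assumes "\<And>n. continuous_map Y euclideanreal (a n)" "uniform_limit (topspace Y) a u sequentially"
  shows "continuous_map Y euclideanreal u"
  using Met_TC.continuous_map_uniform_limit[of Y a sequentially u] assms
  by (simp add: uniform_limit_iff)

text \<open>The reciprocal of a positive continuous function is continuous, hence bounded.\<close>

lemma pseudocompact_pos_lower_bound:
  assumes "pseudocompact_space Y" "continuous_map Y euclideanreal v"
    and pos: "\<And>y. y \<in> topspace Y \<Longrightarrow> 0 < v y"
  obtains c where "0 < c" "\<And>y. y \<in> topspace Y \<Longrightarrow> c \<le> v y"
proof -
  have "continuous_map Y euclideanreal (\<lambda>y. inverse (v y))"
    using assms(2) pos by (metis continuous_map_real_inverse less_irrefl)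
  then have "bounded ((\<lambda>y. inverse (v y)) ` topspace Y)"
    using assms(1) by (simp add: pseudocompact_space_def)
  then obtain B where "\<forall>x\<in>(\<lambda>y. inverse (v y)) ` topspace Y. norm x \<le> B"
    by (auto simp only: bounded_iff)
  then have B: "\<bar>inverse (v y)\<bar> \<le> B" if "y \<in> topspace Y" for y
    using that by (metis imageI real_norm_def)
  have "inverse (\<bar>B\<bar> + 1) \<le> v y" if y: "y \<in> topspace Y" for y
  proof -
    have "inverse (v y) \<le> \<bar>B\<bar> + 1" using B[OF y] by linarith
    then have "inverse (\<bar>B\<bar> + 1) \<le> inverse (inverse (v y))"
      using pos[OF y] by (intro le_imp_inverse_le) auto
    then show ?thesis by simp
  qed
  then show thesis using that[of "inverse (\<bar>B\<bar> + 1)"] by simp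
qed

text \<open>If the supremum were not attained, the gap below it would be positive everywhere, hence
  bounded away from zero.\<close>

lemma pseudocompact_attains_sup:
  assumes "pseudocompact_space Y" "topspace Y \<noteq> {}" "continuous_map Y euclideanreal u"
  shows "\<exists>y\<in>topspace Y. \<forall>z\<in>topspace Y. u z \<le> u y"
proof (rule ccontr)
  assume neg: "\<not> ?thesis"
  define s where "s = (SUP y\<in>topspace Y. u y)"
  have bdd: "bdd_above (u ` topspace Y)"
    using assms(1,3) by (auto simp: pseudocompact_space_def intro: bounded_imp_bdd_above)
  have "0 < s - u y" if y: "y \<in> topspace Y" for y
  proof -
    obtain z where "z \<in> topspace Y" "u y < u z" using neg y by (meson not_le)
    then show ?thesis using cSUP_upper[OF _ bdd, of z] by (simp add: s_def)
  qed
  moreover have "continuous_map Y euclideanreal (\<lambda>y. s - u y)"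
    using assms(3) by (intro continuous_intros) auto
  ultimately obtain c where c: "0 < c" "\<And>y. y \<in> topspace Y \<Longrightarrow> c \<le> s - u y"
    using pseudocompact_pos_lower_bound[OF assms(1)] by metis
  have "u y \<le> s - c" if "y \<in> topspace Y" for y using c(2)[OF that] by simp
  then have "(SUP y\<in>topspace Y. u y) \<le> s - c" by (rule cSUP_least[OF assms(2)])
  then have "s \<le> s - c" by (simp add: s_def)
  with c(1) show False by simp
qed

text \<open>The functions in \<open>S\<close> map \<open>Y\<close> into a bounded subset of a
  finite-dimensional space. Cut it into finitely many cells of side \<open>e\<close> and keep one
  point of \<open>Y\<close> for each cell that is hit; \<open>q\<close> records the cell.\<close>

lemma finite_net:
  fixes S :: "('b \<Rightarrow> real) set"
  assumes "finite S" "\<And>f y. f \<in> S \<Longrightarrow> y \<in> Y \<Longrightarrow> \<bar>f y\<bar> \<le> M" "0 < e"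
  obtains A where "finite A" "A \<subseteq> Y" "\<And>y. y \<in> Y \<Longrightarrow> \<exists>a\<in>A. \<forall>f\<in>S. \<bar>f a - f y\<bar> < e"
proof -
  define q where "q y = (\<lambda>f\<in>S. \<lfloor>f y / e\<rfloor>)" for y
  have "q ` Y \<subseteq> PiE S (\<lambda>_. {\<lfloor>- M / e\<rfloor>..\<lfloor>M / e\<rfloor>})"
  proof (rule image_subsetI)
    fix y assume y: "y \<in> Y"
    have "\<lfloor>f y / e\<rfloor> \<in> {\<lfloor>- M / e\<rfloor>..\<lfloor>M / e\<rfloor>}" if "f \<in> S" for f
    proof -
      have "- M \<le> f y" "f y \<le> M" using assms(2)[OF that y] by linarith+
      then have "- M / e \<le> f y / e" "f y / e \<le> M / e"
        using \<open>0 < e\<close> by (intro divide_right_mono; linarith)+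
      then show ?thesis unfolding atLeastAtMost_iff by (intro conjI floor_mono)
    qed
    then show "q y \<in> PiE S (\<lambda>_. {\<lfloor>- M / e\<rfloor>..\<lfloor>M / e\<rfloor>})"
      unfolding q_def by (rule restrict_PiE_iff[THEN iffD2, rule_format])
  qed
  moreover have "finite (PiE S (\<lambda>_. {\<lfloor>- M / e\<rfloor>..\<lfloor>M / e\<rfloor>}))"
    using \<open>finite S\<close> by (intro finite_PiE finite_atLeastAtMost_int)
  ultimately have "finite (q ` Y)" by (rule finite_subset)
  then obtain A where A: "A \<subseteq> Y" "finite A" "q ` Y = q ` A"
    using finite_subset_image[of "q ` Y" q Y] by auto
  have "\<exists>a\<in>A. \<forall>f\<in>S. \<bar>f a - f y\<bar> < e" if "y \<in> Y" for y
  proof -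
    have "q y \<in> q ` A" using A(3) that by blast
    then obtain a where a: "a \<in> A" "q a = q y" by auto
    have "\<bar>f a - f y\<bar> < e" if "f \<in> S" for f
    proof -
      have "\<lfloor>f a / e\<rfloor> = \<lfloor>f y / e\<rfloor>"
        using fun_cong[OF a(2), of f] that by (simp add: q_def)
      then have "\<bar>f a / e - f y / e\<bar> < 1" by linarith
      also have "f a / e - f y / e = (f a - f y) / e" by (simp add: diff_divide_distrib)
      finally show ?thesis using \<open>0 < e\<close> by (simp add: abs_divide)
    qed
    with a show ?thesis by blast
  qed
  with A show thesis using that by blast
qed

lemma continuous_map_Cp_eval:
  assumes "y \<in> topspace Y"
  shows "continuous_map (Cp_space Y) euclideanreal (\<lambda>g. g y)"
  unfolding Cp_space_def using assms
  by (intro continuous_map_from_subtopology continuous_map_product_projection)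

text \<open>Compactness need not give convergent subsequences, so the cluster point is found in the
  intersection of the nested closures of tails. The predicate \<open>P\<close> restricts the tails
  to those indices at which a bound is violated.\<close>

lemma cluster_point_exists:
  fixes r :: "nat \<Rightarrow> 'c"
  assumes "relatively_compact_in T S" "range r \<subseteq> S" "\<And>n. \<exists>k\<ge>n. P k"
  obtains g where "g \<in> topspace T" "\<And>n. g \<in> T closure_of (r ` {k. n \<le> k \<and> P k})"
proof -
  let ?K = "T closure_of S" and ?D = "\<lambda>n. T closure_of (r ` {k. n \<le> k \<and> P k})"
  have ST: "S \<subseteq> topspace T" and K: "compactin T ?K"
    using assms(1) by (auto simp: relatively_compact_in_def)
  have "(\<Inter>n. ?D n) \<noteq> {}"
  proof (rule compact_space_imp_nest)
    show "compact_space (subtopology T ?K)" by (simp add: K compact_space_subtopology)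
    show "closedin (subtopology T ?K) (?D n)" for n
      using assms(2) by (intro closedin_subset_topspace closure_of_mono) auto
    show "?D n \<noteq> {}" for n
    proof -
      obtain k where "n \<le> k" "P k" using assms(3) by blast
      then have "r k \<in> r ` {k. n \<le> k \<and> P k}" by auto
      moreover have "r ` {k. n \<le> k \<and> P k} \<subseteq> ?D n"
        using assms(2) ST by (intro closure_of_subset) auto
      ultimately show ?thesis by blast
    qed
    show "decseq ?D" by (intro antimonoI closure_of_mono) auto
  qed
  then obtain g where g: "\<And>n. g \<in> ?D n" by auto
  then have "g \<in> topspace T"
    using closure_of_subset_topspace[of T "r ` {k. 0 \<le> k \<and> P k}"] by blast
  with g show thesis using that by blast
qed

text \<open>Suppose the sequence built below exceeds \<open>\<beta> + \<delta>\<close> infinitely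
  often at \<open>y0\<close>. A cluster point \<open>g\<close> along those indices is at most
  \<beta> on every \<open>A n\<close>, is large at \<open>y0\<close>, and agrees with
  \<open>g y0\<close> wherever all \<open>f k\<close> agree with their values at \<open>y0\<close>.
  But points of the sets \<open>A n\<close> imitate \<open>y0\<close> arbitrarily well, which
  pseudocompactness turns into a contradiction.\<close>

lemma small_limsup_sequence:
  fixes F :: "('b \<Rightarrow> real) set"
  assumes Y: "pseudocompact_space Y"
    and cont: "\<And>f. f \<in> F \<Longrightarrow> continuous_map Y euclideanreal f"
    and bound: "\<And>f y. f \<in> F \<Longrightarrow> y \<in> topspace Y \<Longrightarrow> \<bar>f y\<bar> \<le> M"
    and comp: "relatively_compact_in (Cp_space Y) ((\<lambda>f. restrict f (topspace Y)) ` F)"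
    and small: "\<And>A. finite A \<Longrightarrow> A \<subseteq> topspace Y \<Longrightarrow> \<exists>f\<in>F. \<forall>a\<in>A. f a < \<beta>"
  shows "\<exists>f. (\<forall>n::nat. f n \<in> F) \<and>
    (\<forall>y\<in>topspace Y. \<forall>\<delta>>0. \<exists>n. \<forall>k\<ge>n. f k y < \<beta> + \<delta>)"
proof -
  \<comment> \<open>Small enough that \<open>n + 1\<close> errors of size \<open>e n\<close> still
    add up to only \<open>1 / (n + 1)\<close>.\<close>
  define e where "e n = 1 / (real n + 1)^2" for n
  have e: "0 < e n" for n by (simp add: e_def)
  have "\<forall>A. \<exists>f. finite A \<and> A \<subseteq> topspace Y \<longrightarrow> f \<in> F \<and> (\<forall>a\<in>A. f a < \<beta>)"
    using small by blast
  then obtain P where P: "\<And>A. finite A \<and> A \<subseteq> topspace Y \<Longrightarrow> P A \<in> F \<and> (\<forall>a\<in>A. P A a < \<beta>)"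
    by metis
  have "\<forall>n S. \<exists>A. finite S \<and> S \<subseteq> F \<longrightarrow> finite A \<and> A \<subseteq> topspace Y \<and>
      (\<forall>y\<in>topspace Y. \<exists>a\<in>A. \<forall>f\<in>S. \<bar>f a - f y\<bar> < e n)"
  proof (intro allI)
    fix n S
    show "\<exists>A. finite S \<and> S \<subseteq> F \<longrightarrow> finite A \<and> A \<subseteq> topspace Y \<and>
      (\<forall>y\<in>topspace Y. \<exists>a\<in>A. \<forall>f\<in>S. \<bar>f a - f y\<bar> < e n)"
    proof (cases "finite S \<and> S \<subseteq> F")
      case True
      then show ?thesis
        using finite_net[of S "topspace Y" M "e n"] bound e by (metis subsetD)
    qed auto
  qed
  then obtain N where N: "\<And>n S. finite S \<and> S \<subseteq> F \<Longrightarrow> finite (N n S) \<and> N n S \<subseteq> topspace Y \<and>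
      (\<forall>y\<in>topspace Y. \<exists>a\<in>N n S. \<forall>f\<in>S. \<bar>f a - f y\<bar> < e n)"
    by metis
  \<comment> \<open>The state holds the functions and the points chosen so far. A new function is
    small on the old points; then a net for all functions including the new one is added.\<close>
  define st where "st = rec_nat ({}, {})
    (\<lambda>n (S, A). (insert (P A) S, A \<union> N n (insert (P A) S)))"
  define S where "S n = fst (st n)" for n
  define A where "A n = snd (st n)" for n
  define f where "f n = P (A n)" for n
  have S0: "S 0 = {}" "A 0 = {}" by (auto simp: S_def A_def st_def)
  have S_Suc: "S (Suc n) = insert (f n) (S n)" and A_Suc: "A (Suc n) = A n \<union> N n (S (Suc n))" for n
    by (auto simp: S_def A_def st_def f_def split: prod.split)
  have inv: "finite (S n) \<and> S n \<subseteq> F \<and> finite (A n) \<and> A n \<subseteq> topspace Y" for n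
  proof (induction n)
    case 0
    then show ?case by (simp add: S0)
  next
    case (Suc n)
    then have "f n \<in> F" unfolding f_def using P by blast
    with Suc have "finite (S (Suc n)) \<and> S (Suc n) \<subseteq> F" by (simp add: S_Suc)
    with N[OF this, of n] Suc show ?case unfolding A_Suc by blast
  qed
  have fF: "f n \<in> F" and f_A: "a \<in> A n \<Longrightarrow> f n a < \<beta>" for n a
    using P inv unfolding f_def by blast+
  have S_eq: "S n = f ` {..<n}" for n
    by (induction n) (auto simp: S0 S_Suc lessThan_Suc)
  have "mono A" unfolding mono_iff_le_Suc by (auto simp: A_Suc)
  then have A_mono: "A n \<subseteq> A k" if "n \<le> k" for n k using that by (rule monoD)
  have net: "\<exists>a\<in>A (Suc n). \<forall>k\<le>n. \<bar>f k a - f k y\<bar> < e n" if "y \<in> topspace Y" for y n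
  proof -
    have "finite (S (Suc n)) \<and> S (Suc n) \<subseteq> F" using inv by simp
    from N[OF this, of n] that obtain a
      where a: "a \<in> N n (S (Suc n))" "\<forall>f\<in>S (Suc n). \<bar>f a - f y\<bar> < e n" by blast
    have "\<bar>f k a - f k y\<bar> < e n" if "k \<le> n" for k
      using a(2) that by (simp add: S_eq)
    with a(1) show ?thesis unfolding A_Suc by blast
  qed
  have AY: "a \<in> topspace Y" if "a \<in> A n" for a n using inv that by blast
  have "\<exists>n. \<forall>k\<ge>n. f k y0 < \<beta> + \<delta>" if y0: "y0 \<in> topspace Y" and "0 < \<delta>" for y0 \<delta>
  proof (rule ccontr)
    assume "\<not> ?thesis"
    then have inf: "\<exists>k\<ge>n. \<beta> + \<delta> \<le> f k y0" for n by (meson not_le)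
    define r where "r k = restrict (f k) (topspace Y)" for k
    have rF: "range r \<subseteq> (\<lambda>f. restrict f (topspace Y)) ` F"
      using fF by (auto simp: r_def)
    obtain g where gT: "g \<in> topspace (Cp_space Y)"
      and g: "\<And>n. g \<in> Cp_space Y closure_of (r ` {k. n \<le> k \<and> \<beta> + \<delta> \<le> f k y0})"
      using cluster_point_exists[OF comp rF inf] by blast
    have g_cont: "continuous_map Y euclideanreal g" using gT by (auto simp: Cp_space_def)
    have g_A: "g a \<le> \<beta>" if a: "a \<in> A n" for a n
    proof (rule closure_of_real_le[OF continuous_map_Cp_eval[OF AY[OF a]] g[of n]])
      fix h assume "h \<in> r ` {k. n \<le> k \<and> \<beta> + \<delta> \<le> f k y0}"
      then obtain k where k: "n \<le> k" "h = r k" by auto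
      with a A_mono have "a \<in> A k" by blast
      then show "h a \<le> \<beta>" using f_A[of a k] AY k(2) by (auto simp: r_def)
    qed
    have g_y0: "\<beta> + \<delta> \<le> g y0"
    proof -
      \<comment> \<open>Negated, because \<open>closure_of_real_le\<close> transfers upper bounds
        only.\<close>
      have "- g y0 \<le> - (\<beta> + \<delta>)"
        by (rule closure_of_real_le[OF continuous_map_minus[OF continuous_map_Cp_eval[OF y0]] g[of 0]])
           (use y0 in \<open>auto simp: r_def\<close>)
      then show ?thesis by simp
    qed
    have g_eq: "g y = g y0" if y: "y \<in> topspace Y" and eq: "\<And>k. f k y = f k y0" for y
    proof -
      have "\<bar>g y - g y0\<bar> \<le> 0"
        by (rule closure_of_real_le[OF _ g[of 0], of "\<lambda>g. \<bar>g y - g y0\<bar>"])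
           (use y y0 eq in \<open>auto simp: r_def intro!: continuous_intros continuous_map_Cp_eval\<close>)
      then show ?thesis by simp
    qed
    \<comment> \<open>The weights make the series converge uniformly, so \<phi> is continuous; it
      vanishes exactly where no \<open>f k\<close> separates the point from
      \<open>y0\<close>.\<close>
    define t where "t k y = (1/2)^k * \<bar>f k y - f k y0\<bar>" for k y
    have t_nonneg: "0 \<le> t k y" for k y by (simp add: t_def)
    have t_le: "norm (t k y) \<le> (1/2)^k * (2 * M)" if "y \<in> topspace Y" for k y
      using bound[OF fF that, of k] bound[OF fF y0, of k]
      by (auto simp: t_def abs_mult intro!: mult_left_mono)
    have summ: "summable (\<lambda>k. (1/2)^k * (2 * M))" by (intro summable_mult2 summable_geometric) simp
    define \<phi> where "\<phi> y = (\<Sum>k. t k y)" for y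
    have unif: "uniform_limit (topspace Y) (\<lambda>n y. \<Sum>k<n. t k y) \<phi> sequentially"
      unfolding \<phi>_def by (rule Weierstrass_m_test[OF t_le summ])
    have t_cont: "continuous_map Y euclideanreal (t k)" for k
      unfolding t_def using cont[OF fF]
      by (intro continuous_intros continuous_map_real_mult_left) auto
    have \<phi>_cont: "continuous_map Y euclideanreal \<phi>"
      by (rule continuous_map_uniform_limit_real[OF _ unif]) (intro continuous_intros t_cont; simp)
    have t_le_\<phi>: "t k y \<le> \<phi> y" if "y \<in> topspace Y" for k y
    proof -
      have "summable (\<lambda>k. t k y)"
        by (rule summable_comparison_test'[OF summ, of 0]) (use t_le that in auto)
      from sum_le_suminf[OF this, of "{k}"] show ?thesis by (simp add: t_nonneg \<phi>_def)
    qed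
    \<comment> \<open>Positive everywhere, yet arbitrarily small on the sets \<open>A n\<close>, which pseudocompactness forbids.\<close>
    define v where "v y = \<phi> y + max 0 (g y - \<beta>)" for y
    have "continuous_map Y euclideanreal v"
      unfolding v_def using \<phi>_cont g_cont by (intro continuous_intros) auto
    moreover have "0 < v y" if y: "y \<in> topspace Y" for y
    proof (cases "\<phi> y \<le> 0")
      case True
      have "t k y = 0" for k using t_le_\<phi>[OF y, of k] t_nonneg[of k y] True by linarith
      then have "f k y = f k y0" for k by (simp add: t_def)
      from g_eq[OF y this] g_y0 \<open>0 < \<delta>\<close> have "0 < g y - \<beta>" by linarith
      moreover have "0 \<le> \<phi> y" using t_le_\<phi>[OF y, of 0] t_nonneg[of 0 y] by linarith
      ultimately show ?thesis by (simp add: v_def)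
    qed (auto simp: v_def)
    ultimately obtain c where c: "0 < c" "\<And>y. y \<in> topspace Y \<Longrightarrow> c \<le> v y"
      using pseudocompact_pos_lower_bound[OF Y] by metis
    have "\<forall>\<^sub>F n in sequentially. \<forall>y\<in>topspace Y. dist (\<Sum>k<n. t k y) (\<phi> y) < c / 2"
      by (intro uniform_limitD[OF unif]) (simp add: c(1))
    then obtain n1 where n1: "\<And>n y. n1 \<le> n \<Longrightarrow> y \<in> topspace Y \<Longrightarrow> dist (\<Sum>k<n. t k y) (\<phi> y) < c / 2"
      by (auto simp: eventually_sequentially)
    obtain n2 where n2: "1 / (real n2 + 1) < c / 2"
      using c(1) nat_approx_posE[of "c / 2"] by (metis Suc_eq_plus1 half_gt_zero of_nat_1 of_nat_add add.commute of_nat_Suc)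
    define n where "n = max n1 n2"
    have n: "1 / (real n + 1) < c / 2"
      by (rule le_less_trans[OF _ n2]) (auto simp: n_def intro!: divide_left_mono)
    \<comment> \<open>At this \<open>a\<close> the first \<open>n + 1\<close> terms of the series
      sum to less than \<open>c / 2\<close>, the rest is below \<open>c / 2\<close> by the choice of
      \<open>n1\<close>, and \<open>g a \<le> \<beta>\<close> removes the second summand of
      \<open>v\<close>.\<close>
    obtain a where a: "a \<in> A (Suc n)" "\<And>k. k \<le> n \<Longrightarrow> \<bar>f k a - f k y0\<bar> < e n"
      using net[OF y0, of n] by blast
    have aY: "a \<in> topspace Y" using AY a(1) .
    have "(\<Sum>k<Suc n. t k a) \<le> (\<Sum>k<Suc n. e n)"
    proof (rule sum_mono)
      fix k assume "k \<in> {..<Suc n}"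
      then have "\<bar>f k a - f k y0\<bar> \<le> e n" using a(2)[of k] by simp
      moreover have "(1/2::real)^k \<le> 1" by (simp add: power_le_one)
      ultimately show "t k a \<le> e n"
        unfolding t_def using mult_mono[of "(1/2::real)^k" 1 "\<bar>f k a - f k y0\<bar>" "e n"] by simp
    qed
    also have "\<dots> = 1 / (real n + 1)" by (simp add: e_def power2_eq_square add.commute)
    finally have "(\<Sum>k<Suc n. t k a) < c / 2" using n by linarith
    moreover have "n1 \<le> Suc n" by (simp add: n_def)
    note n1[OF this aY]
    ultimately have "\<phi> a < c" unfolding dist_real_def by linarith
    moreover have "v a = \<phi> a" using g_A[OF a(1)] by (simp add: v_def)
    ultimately show False using c(2)[OF aY] by simp
  qed
  with fF show ?thesis by blast
qed

text \<open>The pointwise bounds place the hull in a product of compact intervals, so its closure in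
  the full product is compact. Convex combinations and pointwise limits inherit the equicontinuity
  estimates, so this closure consists of continuous functions and is also the closure in
  \<open>Cp_space Y\<close>.\<close>

lemma equicontinuous_imp_relatively_compact:
  fixes S :: "('b \<Rightarrow> real) set"
  assumes equi: "equicontinuous_on Y S"
    and bound: "\<And>f y. f \<in> S \<Longrightarrow> y \<in> topspace Y \<Longrightarrow> \<bar>f y\<bar> \<le> B y"
  shows "relatively_compact_in (Cp_space Y) ((\<lambda>f. restrict f (topspace Y)) ` (convex hull S))"
proof -
  let ?P = "powertop_real (topspace Y)" and ?C = "{f. continuous_map Y euclideanreal f}"
  define R where "R = (\<lambda>f. restrict f (topspace Y)) ` (convex hull S)"
  define W where "W = PiE (topspace Y) (\<lambda>y. {- B y..B y})"
  have "\<bar>f y\<bar> \<le> B y" if "f \<in> convex hull S" "y \<in> topspace Y" for f y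
    by (rule convex_hull_linear_abs_le[OF linear_eval that(1)]) (use bound that(2) in auto)
  then have RW: "R \<subseteq> W" by (fastforce simp: R_def W_def abs_le_iff)
  have W: "compactin ?P W" unfolding W_def by (simp add: compactin_PiE)
  then have "closedin ?P W"
    by (rule compactin_imp_closedin[rotated]) (simp add: Hausdorff_space_product_topology)
  with RW have clW: "?P closure_of R \<subseteq> W" by (rule closure_of_minimal)
  have comp: "compactin ?P (?P closure_of R)"
    using closed_compactin[OF W clW] by simp
  have R_cl: "R \<subseteq> ?P closure_of R"
    using RW compactin_subset_topspace[OF W] by (intro closure_of_subset) auto
  have cl_cont: "?P closure_of R \<subseteq> ?C"
  proof safe
    fix g assume g: "g \<in> ?P closure_of R"
    have "\<exists>U. openin Y U \<and> y \<in> U \<and> (\<forall>z\<in>U. dist (g y) (g z) < \<epsilon>)"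
      if y: "y \<in> topspace Y" and "0 < \<epsilon>" for y \<epsilon>
    proof -
      obtain U where U: "openin Y U" "y \<in> U" "\<And>f z. f \<in> S \<Longrightarrow> z \<in> U \<Longrightarrow> \<bar>f z - f y\<bar> < \<epsilon> / 2"
        using equi y \<open>0 < \<epsilon>\<close> unfolding equicontinuous_on_def by (meson half_gt_zero)
      have "\<bar>g z - g y\<bar> \<le> \<epsilon> / 2" if z: "z \<in> U" for z
      proof (rule closure_of_real_le[OF _ g, of "\<lambda>g. \<bar>g z - g y\<bar>"])
        have zY: "z \<in> topspace Y" using U(1) z openin_subset by blast
        then show "continuous_map ?P euclideanreal (\<lambda>g. \<bar>g z - g y\<bar>)"
          using y by (intro continuous_intros) auto
        fix h assume "h \<in> R"
        then obtain f where f: "f \<in> convex hull S" "h = restrict f (topspace Y)"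
          by (auto simp: R_def)
        have "\<bar>f z - f y\<bar> \<le> \<epsilon> / 2"
          by (rule convex_hull_linear_abs_le[OF linear_eval_diff f(1)]) (use U(3) z in force)
        then show "\<bar>h z - h y\<bar> \<le> \<epsilon> / 2" using f(2) y zY by simp
      qed
      then have "\<forall>z\<in>U. dist (g y) (g z) < \<epsilon>"
        using \<open>0 < \<epsilon>\<close> by (fastforce simp: dist_real_def abs_minus_commute)
      with U show ?thesis by blast
    qed
    then show "continuous_map Y euclideanreal g"
      using Met_TC.continuous_map_to_metric[of Y g] by simp
  qed
  have "Cp_space Y closure_of R = ?P closure_of R"
    using R_cl cl_cont by (auto simp: Cp_space_def closure_of_subtopology Int_absorb1)
  moreover have "R \<subseteq> topspace (Cp_space Y)"
    using R_cl cl_cont closure_of_subset_topspace[of ?P R] by (auto simp: Cp_space_def)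
  ultimately show ?thesis
    using comp cl_cont by (simp add: relatively_compact_in_def Cp_space_def compactin_subtopology flip: R_def)
qed

subsection \<open>The minimax inequality\<close>

text \<open>Carries infsup-convexity from indexed combinations over to arbitrary elements of the
  hull.\<close>

lemma convex_hull_sections_SUP_ge:
  assumes conv: "infsup_convex X Y H" and f: "f \<in> convex hull (H ` X)"
  shows "(INF x\<in>X. SUP y\<in>Y. ereal (H x y)) \<le> (SUP y\<in>Y. ereal (f y))"
proof -
  from f obtain k u g where u: "\<forall>i\<in>{1::nat..k}. 0 \<le> u i \<and> g i \<in> H ` X" "sum u {1..k} = 1"
    and fe: "(\<Sum>i = 1..k. u i *\<^sub>R g i) = f"
    unfolding convex_hull_indexed mem_Collect_eq by blast
  \<comment> \<open>Different points of \<open>X\<close> may have the same section; any preimage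
    serves.\<close>
  define x where "x i = inv_into X H (g i)" for i
  have x: "x i \<in> X" "H (x i) = g i" if "i \<in> {1..k}" for i
    using bspec[OF u(1) that] by (auto simp: x_def inv_into_into f_inv_into_f)
  have "k \<noteq> 0" using u(2) by (intro notI) simp
  let ?T = "{(n, x, l). 1 \<le> n \<and> x \<in> {1..n} \<rightarrow> X \<and> l \<in> std_simplex n}"
  have T: "(k, x, u) \<in> ?T"
    using \<open>k \<noteq> 0\<close> x u by (auto simp: std_simplex_def)
  have "f y = (\<Sum>i = 1..k. u i * H (x i) y)" for y
    unfolding fe[symmetric] fun_sum_scaleR_apply using x(2) by (intro sum.cong) auto
  then show ?thesis
    unfolding conv[unfolded infsup_convex_def]
    using INF_lower[OF T, of "\<lambda>(n, x, l). SUP y\<in>Y. ereal (\<Sum>i=1..n. l i * H (x i) y)"]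
    by (simp only: prod.case)
qed

lemma supinf_concave_finite_weights:
  assumes conc: "supinf_concave X Y L" and A: "finite A" "A \<subseteq> Y" "A \<noteq> {}"
    and \<mu>: "\<And>a. a \<in> A \<Longrightarrow> 0 \<le> \<mu> a" "sum \<mu> A = 1"
  shows "(INF x\<in>X. ereal (\<Sum>a\<in>A. \<mu> a * L x a)) \<le> (SUP y\<in>Y. INF x\<in>X. ereal (L x y))"
proof -
  obtain h where h: "bij_betw h {1..card A} A"
    using ex_bij_betw_nat_finite_1[OF A(1)] by blast
  have hA: "h i \<in> A" if "i \<in> {1..card A}" for i using h that by (auto simp: bij_betw_def)
  have re: "(\<Sum>i = 1..card A. k (h i)) = sum k A" for k :: "_ \<Rightarrow> real"
    using sum.reindex_bij_betw[OF h] .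
  let ?T = "{(n, y, l). 1 \<le> n \<and> y \<in> {1..n} \<rightarrow> Y \<and> l \<in> std_simplex n}"
  have "card A \<noteq> 0" using A by simp
  then have T: "(card A, h, \<lambda>i. \<mu> (h i)) \<in> ?T"
    using hA A(2) \<mu> re[of \<mu>] by (auto simp: std_simplex_def)
  have eq: "(\<Sum>i = 1..card A. \<mu> (h i) * L x (h i)) = (\<Sum>a\<in>A. \<mu> a * L x a)" for x
    by (rule re)
  show ?thesis
    unfolding conc[unfolded supinf_concave_def]
    using SUP_upper[OF T, of "\<lambda>(n, y, l). INF x\<in>X. ereal (\<Sum>i=1..n. l i * L x (y i))"]
    by (simp only: prod.case eq)
qed

theorem theorem3:
  fixes X :: "'a set" and Y :: "'b topology" and H L :: "'a \<Rightarrow> 'b \<Rightarrow> real"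
  assumes "X \<noteq> {}"
    and "completely_regular_space Y" "Hausdorff_space Y" "pseudocompact_space Y"
    and "bounded ((\<lambda>(x, y). H x y) ` (X \<times> topspace Y))"
    and "\<And>y. y \<in> topspace Y \<Longrightarrow> bounded ((\<lambda>x. L x y) ` X)"
  shows "(infsup_convex X (topspace Y) H \<and>
          relatively_compact_in (Cp_space Y) (conv_sections X (topspace Y) H) \<and>
          supinf_concave X (topspace Y) L \<and>
          (\<forall>x\<in>X. \<forall>y\<in>topspace Y. H x y \<le> L x y) \<longrightarrow>
          (INF x\<in>X. SUP y\<in>topspace Y. ereal (H x y))
            \<le> (SUP y\<in>topspace Y. INF x\<in>X. ereal (L x y))) \<and>
         (equicontinuous_on Y (H ` X) \<longrightarrow>
          relatively_compact_in (Cp_space Y) (conv_sections X (topspace Y) H))"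
proof (intro conjI impI)
  obtain M where "\<forall>z\<in>(\<lambda>(x, y). H x y) ` (X \<times> topspace Y). norm z \<le> M"
    using assms(5) unfolding bounded_iff by blast
  then have M: "\<bar>f y\<bar> \<le> M" if "f \<in> H ` X" "y \<in> topspace Y" for f y
    using that by force
  {
    assume "equicontinuous_on Y (H ` X)"
    then show "relatively_compact_in (Cp_space Y) (conv_sections X (topspace Y) H)"
      unfolding conv_sections_def
      by (rule equicontinuous_imp_relatively_compact) (rule M)
  }
  assume "infsup_convex X (topspace Y) H \<and>
          relatively_compact_in (Cp_space Y) (conv_sections X (topspace Y) H) \<and>
          supinf_concave X (topspace Y) L \<and>
          (\<forall>x\<in>X. \<forall>y\<in>topspace Y. H x y \<le> L x y)"
  then have convH: "infsup_convex X (topspace Y) H"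
    and comp: "relatively_compact_in (Cp_space Y) (conv_sections X (topspace Y) H)"
    and concL: "supinf_concave X (topspace Y) L"
    and HL: "\<And>x y. x \<in> X \<Longrightarrow> y \<in> topspace Y \<Longrightarrow> H x y \<le> L x y" by auto
  define F where "F = convex hull (H ` X)"
  have F_bound: "\<bar>f y\<bar> \<le> M" if "f \<in> F" "y \<in> topspace Y" for f y
    by (rule convex_hull_linear_abs_le[OF linear_eval that(1)[unfolded F_def]]) (rule M[OF _ that(2)])
  have F_comp: "relatively_compact_in (Cp_space Y) ((\<lambda>f. restrict f (topspace Y)) ` F)"
    using comp by (simp add: conv_sections_def F_def)
  \<comment> \<open>Elements of \<open>F\<close> also carry values off the space, so continuity is
    read off from their restrictions, which lie in \<open>Cp_space Y\<close>.\<close>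
  have F_cont: "continuous_map Y euclideanreal f" if "f \<in> F" for f
  proof (rule continuous_map_eq)
    show "continuous_map Y euclideanreal (restrict f (topspace Y))"
      using F_comp that by (auto simp: relatively_compact_in_def Cp_space_def)
  qed simp
  show "(INF x\<in>X. SUP y\<in>topspace Y. ereal (H x y)) \<le> (SUP y\<in>topspace Y. INF x\<in>X. ereal (L x y))"
    (is "?I \<le> ?S")
  proof (cases "topspace Y = {}")
    case True
    \<comment> \<open>Over an empty space both sides are minus infinity, as \<open>X\<close> is
      nonempty.\<close>
    then show ?thesis using \<open>X \<noteq> {}\<close> by simp
  next
    case False
    show ?thesis
    proof (rule ccontr)
      assume "\<not> ?I \<le> ?S"
      then have "?S < ?I" by simp
      from ereal_dense2[OF this] obtain \<beta> where \<beta>: "?S < ereal \<beta>" "ereal \<beta> < ?I" by blast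
      from ereal_dense2[OF \<beta>(2)] obtain m where m: "\<beta> < m" "ereal m < ?I" by auto
      have small: "\<exists>f\<in>F. \<forall>a\<in>A. f a < \<beta>" if A: "finite A" "A \<subseteq> topspace Y" for A
      proof (cases "A = {}")
        case True
        then show ?thesis using \<open>X \<noteq> {}\<close> by (auto simp: F_def)
      next
        case ne: False
        show ?thesis
        proof (rule ccontr)
          assume "\<not> ?thesis"
          then have big: "\<exists>a\<in>A. \<beta> \<le> f a" if "f \<in> F" for f using that by (meson not_le)
          have "convex F" by (simp add: F_def convex_convex_hull)
          \<comment> \<open>The weights obtained here would push the lower value of \<open>L\<close>
            up to \<beta>, through \<open>H \<le> L\<close> and supinf-concavity.\<close>
          from finite_alternative[OF A(1) ne \<open>convex F\<close> big]
          obtain \<mu> where \<mu>: "\<forall>a\<in>A. 0 \<le> \<mu> a" "sum \<mu> A = 1"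
            "\<forall>f\<in>F. \<beta> \<le> (\<Sum>a\<in>A. \<mu> a * f a)" by blast
          have "ereal \<beta> \<le> (INF x\<in>X. ereal (\<Sum>a\<in>A. \<mu> a * L x a))"
          proof (rule INF_greatest)
            fix x assume x: "x \<in> X"
            then have "\<beta> \<le> (\<Sum>a\<in>A. \<mu> a * H x a)"
              by (intro bspec[OF \<mu>(3)]) (simp add: F_def hull_inc)
            also have "\<dots> \<le> (\<Sum>a\<in>A. \<mu> a * L x a)"
              using \<mu>(1) HL[OF x] A(2) by (intro sum_mono mult_left_mono) auto
            finally show "ereal \<beta> \<le> ereal (\<Sum>a\<in>A. \<mu> a * L x a)" by simp
          qed
          also have "\<dots> \<le> ?S"
            using \<mu>(1,2) by (intro supinf_concave_finite_weights[OF concL A ne]) auto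
          finally show False using \<beta>(1) by simp
        qed
      qed
      have "\<exists>f. (\<forall>n::nat. f n \<in> F) \<and>
          (\<forall>y\<in>topspace Y. \<forall>\<delta>>0. \<exists>n. \<forall>k\<ge>n. f k y < \<beta> + \<delta>)"
        by (rule small_limsup_sequence[of Y F M])
           (rule assms(4) F_comp | erule F_cont | erule (1) F_bound | erule (1) small)+
      then obtain f where f: "\<And>n::nat. f n \<in> F"
        "\<forall>y\<in>topspace Y. \<forall>\<delta>>0. \<exists>n. \<forall>k\<ge>n. f k y < \<beta> + \<delta>" by blast
      have hull: "convex hull (range f) \<subseteq> F"
        unfolding F_def by (rule hull_minimal) (use f(1) in \<open>auto simp: F_def convex_convex_hull\<close>)
      have attains: "\<exists>y\<in>topspace Y. \<forall>z\<in>topspace Y. u z \<le> u y"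
        if "\<And>n. a n \<in> convex hull (range f)" "uniform_limit (topspace Y) a u sequentially" for a u
      proof (rule pseudocompact_attains_sup[OF assms(4) False])
        show "continuous_map Y euclideanreal u"
          by (rule continuous_map_uniform_limit_real[OF F_cont that(2)]) (use hull that(1) in blast)
      qed
      have lower: "m \<le> (SUP y\<in>topspace Y. h y)" if "h \<in> convex hull (range f)" for h
      proof -
        have hF: "h \<in> F" using that hull by blast
        have bdd: "bdd_above (h ` topspace Y)"
          using F_bound[OF hF] by (intro bdd_aboveI2[of _ _ M]) (auto simp: abs_le_iff)
        have "ereal m \<le> ?I" using m by simp
        also have "\<dots> \<le> (SUP y\<in>topspace Y. ereal (h y))"
          by (rule convex_hull_sections_SUP_ge[OF convH hF[unfolded F_def]])
        also have "\<dots> \<le> ereal (SUP y\<in>topspace Y. h y)"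
          by (rule SUP_least) (simp add: cSUP_upper bdd)
        finally show ?thesis by simp
      qed
      \<comment> \<open>Chosen so that \<open>m - 2 * \<delta>\<close> equals
        \<open>\<beta> + \<delta>\<close>: the lower bound from Simons' inequality then meets the
        strict upper bound on the tail of the sequence.\<close>
      define \<delta> where "\<delta> = (m - \<beta>) / 3"
      have "0 < \<delta>" using m by (simp add: \<delta>_def)
      have "\<exists>y\<in>topspace Y. \<forall>n. \<exists>k\<ge>n. m - 2 * \<delta> \<le> f k y"
        by (rule Simons_inequality[of "topspace Y" f M])
           (rule False \<open>0 < \<delta>\<close> | erule F_bound[OF f(1)] lower | erule (1) attains)+
      then obtain y where y: "y \<in> topspace Y" "\<forall>n. \<exists>k\<ge>n. m - 2 * \<delta> \<le> f k y" by blast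
      obtain n where "\<And>k. n \<le> k \<Longrightarrow> f k y < \<beta> + \<delta>"
        using f(2)[rule_format, OF y(1) \<open>0 < \<delta>\<close>] by blast
      moreover obtain k where "n \<le> k" "m - 2 * \<delta> \<le> f k y" using y(2) by blast
      ultimately have "m - 2 * \<delta> < \<beta> + \<delta>" by force
      then show False by (simp add: \<delta>_def field_simps)
    qed
  qed
qed

end
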